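(* Let $F$ be a field of characteristic two, let $(A,\sigma)$ be a totally decomposable central simple $F$-algebra with anisotropic orthogonal involution, and let $S$ be an inseparable subalgebra of $(A,\sigma)$. Then $S=\mathrm{Alt}(A,\sigma)^+\oplus F=\mathrm{Sym}(A,\sigma)^+$, and $S$ is a maximal subfield of $A$. In particular, the inseparable subalgebra of $(A,\sigma)$ is uniquely determined.
   Context: Involutions are of the first kind. $(A,\sigma)$ is totally decomposable if it is isomorphic to a tensor product of quaternion $F$-algebras with involution. $\sigma$ is anisotropic if $\sigma(x)x=0$ implies $x=0$. $\mathrm{Alt}(A,\sigma)=\{\sigma(x)-x\mid x\in A\}$, $\mathrm{Alt}(A,\sigma)^+=\{x\in\mathrm{Alt}(A,\sigma)\mid x^2\in F\}$, $\mathrm{Sym}(A,\sigma)^+=\{x\in A\mid\sigma(x)=x,\ x^2\in F\}$. If $\deg_FA=2^n$, an inseparable subalgebra is a $2^n$-dimensional subalgebra $S\subseteq\mathrm{Sym}(A,\sigma)^+$ with $C_A(S)=S$, generated as an $F$-algebra by $n$ elements. *)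

theory Defs
  imports Main "HOL.Vector_Spaces"
begin

definition F_algebra :: "('f::field \<Rightarrow> 'a::ring_1 \<Rightarrow> 'a) \<Rightarrow> bool" where
  "F_algebra sc \<longleftrightarrow> Vector_Spaces.vector_space sc \<and>
     (\<forall>c x y. sc c (x * y) = sc c x * y \<and> sc c (x * y) = x * sc c y)"

definition finite_dim :: "('f::field \<Rightarrow> 'a::ring_1 \<Rightarrow> 'a) \<Rightarrow> bool" where
  "finite_dim sc \<longleftrightarrow> (\<exists>B. finite B \<and> module.span sc B = UNIV)"

definition subalg :: "('f::field \<Rightarrow> 'a::ring_1 \<Rightarrow> 'a) \<Rightarrow> 'a set \<Rightarrow> bool" where
  "subalg sc T \<longleftrightarrow> 1 \<in> T \<and> (\<forall>x\<in>T. \<forall>y\<in>T. x + y \<in> T \<and> x * y \<in> T) \<and>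
     (\<forall>c. \<forall>x\<in>T. sc c x \<in> T)"

definition centralizer :: "'a::ring_1 set \<Rightarrow> 'a set \<Rightarrow> 'a set" where
  "centralizer T S = {z\<in>T. \<forall>x\<in>S. z * x = x * z}"

definition two_sided_ideal :: "'a::ring_1 set \<Rightarrow> 'a set \<Rightarrow> bool" where
  "two_sided_ideal T I \<longleftrightarrow> I \<subseteq> T \<and> 0 \<in> I \<and> (\<forall>x\<in>I. \<forall>y\<in>I. x + y \<in> I \<and> - x \<in> I) \<and>
     (\<forall>a\<in>T. \<forall>x\<in>I. a * x \<in> I \<and> x * a \<in> I)"

definition central_simple_on :: "('f::field \<Rightarrow> 'a::ring_1 \<Rightarrow> 'a) \<Rightarrow> 'a set \<Rightarrow> bool" where
  "central_simple_on sc T \<longleftrightarrow> subalg sc T \<and>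
     centralizer T T = range (\<lambda>c. sc c 1) \<and>
     (\<forall>I. two_sided_ideal T I \<longrightarrow> I = {0} \<or> I = T)"

definition central_simple_algebra :: "('f::field \<Rightarrow> 'a::ring_1 \<Rightarrow> 'a) \<Rightarrow> bool" where
  "central_simple_algebra sc \<longleftrightarrow> F_algebra sc \<and> finite_dim sc \<and> central_simple_on sc UNIV"

definition involution_first_kind :: "('f::field \<Rightarrow> 'a::ring_1 \<Rightarrow> 'a) \<Rightarrow> ('a \<Rightarrow> 'a) \<Rightarrow> bool" where
  "involution_first_kind sc \<sigma> \<longleftrightarrow>
     (\<forall>x y. \<sigma> (x + y) = \<sigma> x + \<sigma> y) \<and> (\<forall>x y. \<sigma> (x * y) = \<sigma> y * \<sigma> x) \<and>
     (\<forall>x. \<sigma> (\<sigma> x) = x) \<and> (\<forall>c x. \<sigma> (sc c x) = sc c (\<sigma> x))"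

definition Alt :: "('a::ring_1 \<Rightarrow> 'a) \<Rightarrow> 'a set" where
  "Alt \<sigma> = {\<sigma> x - x | x. True}"

definition Alt_plus :: "('f::field \<Rightarrow> 'a::ring_1 \<Rightarrow> 'a) \<Rightarrow> ('a \<Rightarrow> 'a) \<Rightarrow> 'a set" where
  "Alt_plus sc \<sigma> = {x \<in> Alt \<sigma>. \<exists>c. x * x = sc c 1}"

definition Sym_plus :: "('f::field \<Rightarrow> 'a::ring_1 \<Rightarrow> 'a) \<Rightarrow> ('a \<Rightarrow> 'a) \<Rightarrow> 'a set" where
  "Sym_plus sc \<sigma> = {x. \<sigma> x = x \<and> (\<exists>c. x * x = sc c 1)}"

definition anisotropic :: "('a::ring_1 \<Rightarrow> 'a) \<Rightarrow> bool" where
  "anisotropic \<sigma> \<longleftrightarrow> (\<forall>x. \<sigma> x * x = 0 \<longrightarrow> x = 0)"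

text \<open>In characteristic two, an involution of the first kind is symplectic iff 1 \<in> Alt(A,\<sigma>)
  (Knus--Merkurjev--Rost--Tignol, Prop. 2.6); orthogonal means not symplectic.\<close>
definition orthogonal_char2 :: "('a::ring_1 \<Rightarrow> 'a) \<Rightarrow> bool" where
  "orthogonal_char2 \<sigma> \<longleftrightarrow> 1 \<notin> Alt \<sigma>"

definition quaternion_subalg :: "('f::field \<Rightarrow> 'a::ring_1 \<Rightarrow> 'a) \<Rightarrow> 'a set \<Rightarrow> bool" where
  "quaternion_subalg sc Q \<longleftrightarrow> central_simple_on sc Q \<and> vector_space.dim sc Q = 4"

text \<open>(A,\<sigma>) is totally decomposable: A is the internal tensor product of pairwise commuting
  \<sigma>-stable quaternion subalgebras Q_1,...,Q_m (the restriction of \<sigma> to Q_i being the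
  involution on the i-th factor).\<close>
definition totally_decomposable :: "('f::field \<Rightarrow> 'a::ring_1 \<Rightarrow> 'a) \<Rightarrow> ('a \<Rightarrow> 'a) \<Rightarrow> bool" where
  "totally_decomposable sc \<sigma> \<longleftrightarrow> (\<exists>Qs::'a set list.
     (\<forall>Q\<in>set Qs. quaternion_subalg sc Q \<and> \<sigma> ` Q \<subseteq> Q) \<and>
     (\<forall>i j. i < length Qs \<and> j < length Qs \<and> i \<noteq> j \<longrightarrow>
        (\<forall>x\<in>Qs!i. \<forall>y\<in>Qs!j. x * y = y * x)) \<and>
     vector_space.dim sc (UNIV::'a set) = 4 ^ length Qs \<and>
     module.span sc {prod_list xs | xs. list_all2 (\<in>) xs Qs} = UNIV)"

definition alg_gen :: "('f::field \<Rightarrow> 'a::ring_1 \<Rightarrow> 'a) \<Rightarrow> 'a set \<Rightarrow> 'a set" where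
  "alg_gen sc X = \<Inter>{T. subalg sc T \<and> X \<subseteq> T}"

text \<open>Inseparable subalgebra of (A,\<sigma>), where deg A = 2^n.\<close>
definition inseparable_subalg ::
  "('f::field \<Rightarrow> 'a::ring_1 \<Rightarrow> 'a) \<Rightarrow> ('a \<Rightarrow> 'a) \<Rightarrow> nat \<Rightarrow> 'a set \<Rightarrow> bool" where
  "inseparable_subalg sc \<sigma> n S \<longleftrightarrow> subalg sc S \<and> vector_space.dim sc S = 2 ^ n \<and>
     S \<subseteq> Sym_plus sc \<sigma> \<and> centralizer UNIV S = S \<and>
     (\<exists>xs. length xs = n \<and> alg_gen sc (set xs) = S)"

definition subfield :: "('f::field \<Rightarrow> 'a::ring_1 \<Rightarrow> 'a) \<Rightarrow> 'a set \<Rightarrow> bool" where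
  "subfield sc K \<longleftrightarrow> subalg sc K \<and> (\<forall>x\<in>K. \<forall>y\<in>K. x * y = y * x) \<and>
     (\<forall>x\<in>K. x \<noteq> 0 \<longrightarrow> (\<exists>y\<in>K. x * y = 1))"

definition maximal_subfield :: "('f::field \<Rightarrow> 'a::ring_1 \<Rightarrow> 'a) \<Rightarrow> 'a set \<Rightarrow> bool" where
  "maximal_subfield sc K \<longleftrightarrow> subfield sc K \<and> (\<forall>L. subfield sc L \<and> K \<subseteq> L \<longrightarrow> L = K)"

end

theory Submission
  imports Defs
begin

text \<open>
  Each quaternion factor has the form \<open>Q\<^sub>i = F\<langle>e\<^sub>i, u\<^sub>i\<rangle>\<close> with \<open>e\<^sub>i\<close>, \<open>u\<^sub>i\<close> symmetric, \<open>u\<^sub>i\<^sup>2 \<in> F\<close>,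
  \<open>e\<^sub>i\<^sup>2 + e\<^sub>i \<in> F\<close> and \<open>e\<^sub>i u\<^sub>i = u\<^sub>i e\<^sub>i + u\<^sub>i\<close>, so \<open>u\<^sub>i = e\<^sub>i u\<^sub>i + \<sigma>(e\<^sub>i u\<^sub>i)\<close> is alternating. Let
  \<open>S\<^sub>0 = F[u\<^sub>1,\<dots>,u\<^sub>n]\<close> and let \<open>E\<close> be the set of products of distinct \<open>e\<^sub>i\<close>, so that \<open>A\<close> is the sum
  of the \<open>S\<^sub>0 g\<close>, \<open>g \<in> E\<close>. If \<open>x = \<Sum> s\<^sub>g g\<close>, then the cross terms of \<open>\<sigma>(x) x\<close> cancel modulo
  \<open>Alt(A,\<sigma>)\<close>, leaving \<open>\<sigma>(x) x \<equiv> \<Sum> s\<^sub>g\<^sup>2 g\<^sup>2\<close> with \<open>s\<^sub>g\<^sup>2 \<in> F\<close>. The squares \<open>g\<^sup>2\<close> are linearly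
  independent modulo \<open>Alt(A,\<sigma>)\<close>; hence if \<open>\<sigma>(x) x \<in> F\<close>, then \<open>s\<^sub>g\<^sup>2 = 0\<close> for \<open>g \<noteq> 1\<close>, and
  anisotropy gives \<open>x = s\<^sub>1 \<in> S\<^sub>0\<close>. Thus \<open>Sym(A,\<sigma>)\<^sup>+ = S\<^sub>0\<close>. An inseparable subalgebra \<open>S\<close> is therefore
  contained in the commutative \<open>S\<^sub>0\<close>, and \<open>S\<^sub>0 \<subseteq> C\<^sub>A(S) = S\<close>.
\<close>

section \<open>Arithmetic in characteristic two and alternating elements\<close>

locale char2_involution = vector_space sc
  for sc :: "'f::field \<Rightarrow> 'a::ring_1 \<Rightarrow> 'a" +
  fixes \<sigma> :: "'a \<Rightarrow> 'a"
  assumes char2: "(2::'f) = 0"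
    and sc_left: "sc c x * y = sc c (x * y)"
    and sc_right: "x * sc c y = sc c (x * y)"
    and \<sigma>_add: "\<sigma> (x + y) = \<sigma> x + \<sigma> y"
    and \<sigma>_mult: "\<sigma> (x * y) = \<sigma> y * \<sigma> x"
    and \<sigma>_\<sigma> [simp]: "\<sigma> (\<sigma> x) = x"
    and \<sigma>_sc: "\<sigma> (sc c x) = sc c (\<sigma> x)"
begin

lemma sc_add_self [simp]: "(c::'f) + c = 0"
proof -
  have "c + c = 2 * c" by simp
  then show ?thesis using char2 by simp
qed

lemma add_self [simp]: "(x::'a) + x = 0"
proof -
  have "x + x = sc (1 + 1) x" by (simp only: scale_left_distrib scale_one)
  then show ?thesis by simp
qed

lemma add_self_left [simp]: "(x::'a) + (x + y) = y"
  by (simp flip: add.assoc)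

lemma uminus_eq [simp]: "- (x::'a) = x"
  by (simp add: minus_unique)

lemma minus_eq [simp]: "(x::'a) - y = x + y"
  using uminus_eq[of y] by (metis diff_conv_add_uminus)

lemma add_eq_0_iff_eq: "(x::'a) + y = 0 \<longleftrightarrow> x = y"
  by (metis add_self add_self_left add.right_neutral)

lemma \<sigma>_0 [simp]: "\<sigma> 0 = 0"
  using \<sigma>_add[of 0 0] by simp

lemma \<sigma>_1 [simp]: "\<sigma> 1 = 1"
  by (metis \<sigma>_\<sigma> \<sigma>_mult mult.right_neutral mult.left_neutral)

text \<open>Relative to a subspace \<open>B\<close>, so that alternating elements can be followed
  while the factors are adjoined one at a time. The plus sign agrees with the usual minus in
  characteristic two.\<close>

definition Alt_on :: "'a set \<Rightarrow> 'a set" where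
  "Alt_on B = {y + \<sigma> y | y. y \<in> B}"

lemma Alt_on_UNIV: "Alt_on UNIV = Alt \<sigma>"
  by (auto simp: Alt_on_def Alt_def add.commute)

lemma Alt_onI: "y \<in> B \<Longrightarrow> y + \<sigma> y \<in> Alt_on B"
  by (auto simp: Alt_on_def)

lemma subspace_Alt_on:
  assumes "subspace B"
  shows "subspace (Alt_on B)"
proof (rule subspaceI)
  show "0 \<in> Alt_on B" using Alt_onI[OF subspace_0[OF assms]] by simp
next
  fix x y assume "x \<in> Alt_on B" "y \<in> Alt_on B"
  then obtain v w where "v \<in> B" "w \<in> B" "x = v + \<sigma> v" "y = w + \<sigma> w"
    by (auto simp: Alt_on_def)
  then show "x + y \<in> Alt_on B"
    using Alt_onI[OF subspace_add[OF assms, of v w]] by (simp add: \<sigma>_add ac_simps)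
next
  fix c x assume "x \<in> Alt_on B"
  then obtain v where "v \<in> B" "x = v + \<sigma> v" by (auto simp: Alt_on_def)
  then show "sc c x \<in> Alt_on B"
    using Alt_onI[OF subspace_scale[OF assms, of v c]] by (simp add: \<sigma>_sc scale_right_distrib)
qed

lemma \<sigma>_Alt_on: "x \<in> Alt_on B \<Longrightarrow> \<sigma> x = x"
  by (auto simp: Alt_on_def \<sigma>_add add.commute)

text \<open>For \<open>z = \<sigma> x * y\<close> the cross terms
  \<open>\<sigma> x * y + \<sigma> y * x\<close> are \<open>z + \<sigma> z\<close>; hence
  \<open>\<sigma> x * x\<close> is additive in \<open>x\<close> modulo alternating elements.\<close>

lemma norm_sum_mod_Alt:
  assumes "finite I"
  shows "\<sigma> (sum g I) * sum g I + (\<Sum>i\<in>I. \<sigma> (g i) * g i) \<in> Alt_on UNIV"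
  using assms
proof (induction I rule: finite_induct)
  case empty
  show ?case using subspace_0[OF subspace_Alt_on[OF subspace_UNIV]] by simp
next
  case (insert j I)
  let ?x = "g j" and ?y = "sum g I"
  have "\<sigma> ?x * ?y + \<sigma> (\<sigma> ?x * ?y) \<in> Alt_on UNIV" by (rule Alt_onI) simp
  from subspace_add[OF subspace_Alt_on[OF subspace_UNIV] this insert.IH]
  show ?case using insert.hyps by (simp add: \<sigma>_add \<sigma>_mult algebra_simps)
qed

lemma mult_unit_eq_0:
  assumes "u * u = sc a 1" "a \<noteq> 0" "r * u = 0"
  shows "r = 0"
proof -
  have "sc a r = r * u * u" using assms(1) by (simp add: mult.assoc sc_right)
  then show ?thesis using assms by simp
qed

text \<open>In characteristic two \<open>z * u + u * z\<close> is a commutator, and commutators with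
  \<open>u\<close> and \<open>e\<close> strip off the terms one by one. Coefficients may be any
  elements commuting with \<open>e\<close> and \<open>u\<close>: scalars within one factor, or
  elements of the span of the factors already treated.\<close>

lemma quaternion_basis_independent:
  assumes u: "u * u = sc a 1" "a \<noteq> 0" and eu: "e * u = u * e + u"
    and comm: "p * e = e * p" "q * e = e * q" "r * e = e * r" "t * e = e * t"
      "p * u = u * p" "q * u = u * q" "r * u = u * r" "t * u = u * t"
    and z: "p + q * e + r * u + t * (u * e) = 0"
  shows "p = 0 \<and> q = 0 \<and> r = 0 \<and> t = 0"
proof -
  let ?z = "p + q * e + r * u + t * (u * e)"
  have eu': "e * (u * y) = u * (e * y) + u * y" for y
    using eu by (metis mult.assoc distrib_right)
  have uu': "u * (u * y) = sc a y" for y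
    using u(1) by (metis mult.assoc mult.left_neutral sc_left)
  have c': "e * (p * y) = p * (e * y)" "e * (q * y) = q * (e * y)" "e * (r * y) = r * (e * y)"
    "e * (t * y) = t * (e * y)" "u * (p * y) = p * (u * y)" "u * (q * y) = q * (u * y)"
    "u * (r * y) = r * (u * y)" "u * (t * y) = t * (u * y)" for y
    using comm by (metis mult.assoc)+
  note simps = u(1) eu eu' uu' c' comm[symmetric] distrib_left distrib_right mult.assoc sc_left sc_right
  have 1: "q * u + sc a t = ?z * u + u * ?z"
    by (simp add: simps ac_simps)
  then have 1: "q * u + sc a t = 0" using z by simp
  \<comment> \<open>The commutator with \<open>e\<close> removes \<open>sc a t\<close>, which
    commutes with \<open>e\<close>, and reproduces \<open>q * u\<close>.\<close>
  have "q * u = (q * u + sc a t) * e + e * (q * u + sc a t)"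
    by (simp add: simps scale_right_distrib ac_simps)
  then have "q * u = 0" using 1 by simp
  then have q: "q = 0" using mult_unit_eq_0 u by blast
  with 1 have t: "t = 0" using u by simp
  have "r * u = ?z * e + e * ?z"
    using q t by (simp add: simps ac_simps)
  then have "r * u = 0" using z by simp
  then have "r = 0" using mult_unit_eq_0 u by blast
  with q t z show ?thesis by simp
qed

lemma independent_insert_card:
  assumes "independent T" "finite T" "a \<notin> span T"
  shows "independent (insert a T) \<and> finite (insert a T) \<and> card (insert a T) = Suc (card T)"
  using assms span_base[of a T] by (auto simp: independent_insert)

text \<open>An infinite basis has \<open>card\<close> equal to 0, so positivity of \<open>m\<close>
  makes the basis finite, and the exchange bound applies.\<close>

lemma independent_card_le:
  assumes "dim V = m" "m > 0" "independent T" "T \<subseteq> V"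
  shows "card T \<le> m"
proof -
  obtain B where "independent B" "V \<subseteq> span B" "card B = m"
    using assms(1) basis_exists[of V] by metis
  moreover from this have "finite B" using assms(2) card_ge_0_finite by blast
  ultimately show ?thesis
    using independent_span_bound[of B T] assms(3,4) by auto
qed

end

section \<open>Quaternion factors under an anisotropic orthogonal involution\<close>

locale anisotropic_orthogonal = char2_involution sc \<sigma>
  for sc :: "'f::field \<Rightarrow> 'a::ring_1 \<Rightarrow> 'a" and \<sigma> :: "'a \<Rightarrow> 'a" +
  assumes one_notin_Alt: "1 \<notin> Alt_on UNIV"
    and anisotropic: "\<sigma> x * x = 0 \<Longrightarrow> x = 0"
begin

lemma one_neq_0 [simp]: "(1::'a) \<noteq> 0"
  using one_notin_Alt subspace_0[OF subspace_Alt_on[OF subspace_UNIV]] by auto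

lemma sc_1_in_Alt: "sc c 1 \<in> Alt_on UNIV \<longleftrightarrow> c = 0"
proof
  assume *: "sc c 1 \<in> Alt_on UNIV"
  show "c = 0"
  proof (rule ccontr)
    assume "c \<noteq> 0"
    then have "1 \<in> Alt_on UNIV"
      using subspace_scale[OF subspace_Alt_on[OF subspace_UNIV] *, of "inverse c"] by simp
    then show False using one_notin_Alt by simp
  qed
qed (use subspace_0[OF subspace_Alt_on[OF subspace_UNIV]] in simp)

text \<open>Otherwise \<open>u\<close>, \<open>w\<close>, \<open>1\<close>, \<open>x\<close>,
  \<open>y\<close> with \<open>u = x + \<sigma> x\<close> and \<open>w = y + \<sigma> y\<close>
  would be five independent elements in dimension 4: orthogonality keeps \<open>1\<close> out of the
  alternating elements, and a relation involving \<open>x\<close> or \<open>y\<close> turns, on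
  adding its image under \<open>\<sigma>\<close>, into a relation between \<open>u\<close> and
  \<open>w\<close>.\<close>

lemma quaternion_Alt_line:
  assumes Q: "subspace Q" "1 \<in> Q" "dim Q = 4" "\<sigma> ` Q \<subseteq> Q"
    and u: "u \<in> Alt_on Q" "u \<noteq> 0" and w: "w \<in> Alt_on Q"
  shows "\<exists>c. w = sc c u"
proof (rule ccontr)
  assume *: "\<not> ?thesis"
  obtain x where x: "x \<in> Q" "u = x + \<sigma> x" using u by (auto simp: Alt_on_def)
  obtain y where y: "y \<in> Q" "w = y + \<sigma> y" using w by (auto simp: Alt_on_def)
  note sub = subspace_Alt_on[OF subspace_UNIV]
  have uA: "u \<in> Alt_on UNIV" "w \<in> Alt_on UNIV" using u w by (auto simp: Alt_on_def)
  have uQ: "u \<in> Q" "w \<in> Q" using x y Q subspace_add[OF Q(1)] by auto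
  have 1: "independent {u} \<and> finite {u} \<and> card {u} = 1"
    using u by simp
  have 2: "independent {w,u} \<and> finite {w,u} \<and> card {w,u} = Suc 1"
    using independent_insert_card[of "{u}" w] 1 * by (auto simp: span_breakdown_eq add_eq_0_iff_eq)
  have "span {w,u} \<subseteq> Alt_on UNIV"
    using uA by (intro span_minimal sub) auto
  then have 3: "independent {1,w,u} \<and> finite {1,w,u} \<and> card {1,w,u} = Suc (Suc 1)"
    using independent_insert_card[of "{w,u}" 1] 2 one_notin_Alt by auto
  have sym: "\<sigma> z = z" if "z \<in> span {1,w,u}" for z
  proof -
    have "subspace {z. \<sigma> z = z}" by (auto intro!: subspaceI simp: \<sigma>_add \<sigma>_sc)
    then have "span {1,w,u} \<subseteq> {z. \<sigma> z = z}"
      using uA \<sigma>_Alt_on by (intro span_minimal) auto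
    then show ?thesis using that by auto
  qed
  have "x \<notin> span {1,w,u}" using sym[of x] x u by auto
  then have 4: "independent {x,1,w,u} \<and> finite {x,1,w,u} \<and> card {x,1,w,u} = Suc (Suc (Suc 1))"
    using independent_insert_card[of "{1,w,u}" x] 3 by auto
  have "y \<notin> span {x,1,w,u}"
  proof
    assume "y \<in> span {x,1,w,u}"
    then obtain k where "y + sc k x \<in> span {1,w,u}" by (auto simp: span_breakdown_eq[of _ x])
    from sym[OF this] have "\<sigma> y + sc k (\<sigma> x) = y + sc k x" by (simp add: \<sigma>_add \<sigma>_sc)
    then have "y + \<sigma> y = sc k (x + \<sigma> x)"
      by (metis add.assoc add.commute add_self_left scale_right_distrib)
    then show False using * x y by auto
  qed
  then have 5: "independent {y,x,1,w,u} \<and> card {y,x,1,w,u} = 5"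
    using independent_insert_card[of "{x,1,w,u}" y] 4 by auto
  then have "card {y,x,1,w,u} \<le> 4"
    by (intro independent_card_le[OF Q(3)]) (use x y Q uQ in auto)
  then show False using 5 by simp
qed

text \<open>The alternating elements of \<open>Q\<close> form a line through some
  \<open>u = x + \<sigma> x\<close>. This makes \<open>u\<close> invertible with scalar square, and
  a normalised combination of \<open>x * u\<close> and \<open>x\<close> serves as
  \<open>e\<close>.\<close>

lemma quaternion_presentation:
  assumes quat: "quaternion_subalg sc Q" and stable: "\<sigma> ` Q \<subseteq> Q"
  obtains e u a b where "e \<in> Q" "u \<in> Q" "\<sigma> e = e" "\<sigma> u = u" "u * u = sc a 1" "a \<noteq> 0"
    "e * e = e + sc b 1" "e * u = u * e + u" "Q \<subseteq> span {1, e, u, u * e}"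
proof -
  have alg: "subalg sc Q" and cen: "centralizer Q Q = range (\<lambda>c. sc c 1)"
    and simple: "\<And>I. two_sided_ideal Q I \<Longrightarrow> I = {0} \<or> I = Q" and dim: "dim Q = 4"
    using quat by (auto simp: quaternion_subalg_def central_simple_on_def)
  have Q1: "1 \<in> Q" and Qadd: "\<And>x y. x \<in> Q \<Longrightarrow> y \<in> Q \<Longrightarrow> x + y \<in> Q"
    and Qmult: "\<And>x y. x \<in> Q \<Longrightarrow> y \<in> Q \<Longrightarrow> x * y \<in> Q" and Qsc: "\<And>c x. x \<in> Q \<Longrightarrow> sc c x \<in> Q"
    using alg by (auto simp: subalg_def)
  have sub: "subspace Q" by (rule subspaceI) (use Qsc[OF Q1, of 0] Qadd Qsc in auto)
  have Q\<sigma>: "\<And>x. x \<in> Q \<Longrightarrow> \<sigma> x \<in> Q" using stable by auto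
  \<comment> \<open>If \<open>\<sigma>\<close> fixed \<open>Q\<close> pointwise, reversing products
    would make \<open>Q\<close> commutative, hence equal to its centre, of dimension 1.\<close>
  have "\<exists>x\<in>Q. \<sigma> x \<noteq> x"
  proof (rule ccontr)
    assume "\<not> ?thesis"
    then have "x * y = y * x" if "x \<in> Q" "y \<in> Q" for x y
      using that Qmult \<sigma>_mult by metis
    then have "Q = range (\<lambda>c. sc c 1)" using cen by (auto simp: centralizer_def)
    also have "\<dots> = span {1}" by (simp add: span_singleton)
    finally have "dim Q = card {1::'a}" by (simp add: dim_span dim_eq_card_independent)
    then show False using dim by simp
  qed
  then obtain x where x: "x \<in> Q" "\<sigma> x \<noteq> x" by blast
  define u where "u = x + \<sigma> x"
  have uA: "u \<in> Alt_on Q" and uQ: "u \<in> Q" and u0: "u \<noteq> 0" and \<sigma>u: "\<sigma> u = u"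
    using x Q\<sigma> Qadd Alt_onI by (auto simp: u_def add_eq_0_iff_eq \<sigma>_add ac_simps)
  have line: "\<exists>c. y + \<sigma> y = sc c u" if "y \<in> Q" for y
    using quaternion_Alt_line[OF sub Q1 dim stable uA u0] Alt_onI[OF that] by blast
  \<comment> \<open>The line property is applied to \<open>y * u\<close>, whose image under
    \<open>\<sigma>\<close> is \<open>u * \<sigma> y\<close>.\<close>
  have "\<exists>c. y * u + u * \<sigma> y = sc c u" if "y \<in> Q" for y
    using line[of "y * u"] that Qmult uQ by (simp add: \<sigma>_mult \<sigma>u)
  then obtain \<tau> where \<tau>: "\<And>y. y \<in> Q \<Longrightarrow> y * u + u * \<sigma> y = sc (\<tau> y) u" by metis
  text \<open>By the last identity \<open>u Q \<subseteq> Q u\<close>, so \<open>Q u\<close> is a two-sided ideal and \<open>u\<close> is invertible.\<close>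
  define I where "I = {y * u | y. y \<in> Q}"
  have uz: "u * z = (\<sigma> z + sc (\<tau> (\<sigma> z)) 1) * u" if "z \<in> Q" for z
  proof -
    have "u * z = \<sigma> z * u + sc (\<tau> (\<sigma> z)) u"
      using \<tau>[OF Q\<sigma>[OF that]] by (metis \<sigma>_\<sigma> add_self_left)
    then show ?thesis by (simp add: distrib_right sc_left)
  qed
  have "two_sided_ideal Q I"
    unfolding two_sided_ideal_def
  proof (intro conjI ballI)
    show "I \<subseteq> Q" using Qmult uQ by (auto simp: I_def)
    show "0 \<in> I" using subspace_0[OF sub] by (auto simp: I_def intro!: exI[of _ 0])
  next
    fix v w assume "v \<in> I" "w \<in> I"
    then show "v + w \<in> I" "- v \<in> I"
      by (auto simp: I_def distrib_right[symmetric] intro: Qadd)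
  next
    fix v w assume "v \<in> Q" "w \<in> I"
    then obtain y where y: "y \<in> Q" "w = y * u" by (auto simp: I_def)
    have "w * v = y * (\<sigma> v + sc (\<tau> (\<sigma> v)) 1) * u"
      using uz[OF \<open>v \<in> Q\<close>] y by (simp add: mult.assoc)
    moreover have "y * (\<sigma> v + sc (\<tau> (\<sigma> v)) 1) \<in> Q"
      using y \<open>v \<in> Q\<close> Qadd Qmult Qsc Q1 Q\<sigma> by auto
    ultimately show "w * v \<in> I" by (auto simp: I_def)
    show "v * w \<in> I" using y \<open>v \<in> Q\<close> Qmult by (auto simp: I_def mult.assoc[symmetric])
  qed
  moreover have "u \<in> I" using Q1 by (auto simp: I_def intro!: exI[of _ 1])
  ultimately have "1 \<in> I" using simple u0 Q1 by blast
  then obtain v where v: "v * u = 1" by (auto simp: I_def)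
  have \<sigma>x: "\<sigma> x = x + u" by (simp add: u_def)
  \<comment> \<open>The element \<open>u * x * u\<close> is chosen because adding its image gives
    \<open>u * (x + \<sigma> x) * u\<close>, the cube of \<open>u\<close>. It lies on the line
    through \<open>u\<close>, and cancelling \<open>u\<close> with \<open>v\<close> shows that
    \<open>u * u\<close> is scalar.\<close>
  have "u * x * u + \<sigma> (u * x * u) = u * u * u"
    by (simp add: \<sigma>_mult \<sigma>u \<sigma>x distrib_left distrib_right mult.assoc)
  then obtain a where "u * u * u = sc a u" using line[of "u * x * u"] x Qmult uQ by metis
  then have uu: "u * u = sc a 1"
    using v by (metis mult.assoc mult.left_neutral sc_right)
  have a: "a \<noteq> 0" using anisotropic[of u] u0 uu \<sigma>u by auto
  \<comment> \<open>Write \<open>T\<close> for \<open>\<tau> x\<close>. The commutator of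
    \<open>x\<close> with \<open>u\<close> is \<open>T u + a\<close>, so that of
    \<open>x u + T x\<close> is \<open>(T u + a)(u + T) = (a + T^2) u\<close>. This dictates
    \<open>z\<close> and \<open>d\<close>; dividing \<open>z\<close> by \<open>d\<close> will give
    \<open>e\<close>.\<close>
  define z where "z = x * u + sc (\<tau> x) x"
  define d where "d = a + \<tau> x * \<tau> x"
  have xu: "u * x = x * u + sc (\<tau> x) u + sc a 1"
    using \<tau>[OF x(1)] uu unfolding \<sigma>x by (simp add: distrib_left) (metis add.assoc add.commute add_self_left)
  have zQ: "z \<in> Q" using x uQ by (auto simp: z_def intro!: Qadd Qmult Qsc)
  have \<sigma>z: "\<sigma> z = z"
    by (simp add: z_def \<sigma>_add \<sigma>_mult \<sigma>_sc \<sigma>u \<sigma>x distrib_left uu xu scale_right_distrib ac_simps)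
  have zu: "z * u = u * z + sc d u"
  proof -
    have "u * z = (u * x) * u + sc (\<tau> x) (u * x)"
      by (simp add: z_def distrib_left mult.assoc sc_right)
    also have "\<dots> = z * u + sc d u"
      by (simp add: xu z_def d_def distrib_right sc_left uu scale_right_distrib
          scale_left_distrib mult.assoc sc_right ac_simps)
    finally show ?thesis by (simp add: ac_simps)
  qed
  \<comment> \<open>As \<open>d\<close> is the square of the symmetric element
    \<open>u + \<tau> x\<close>, anisotropy would otherwise make \<open>u\<close> a scalar, and the
    only alternating scalar is 0.\<close>
  have d: "d \<noteq> 0"
  proof
    assume "d = 0"
    moreover have "(u + sc (\<tau> x) 1) * (u + sc (\<tau> x) 1) = sc d 1"
      by (simp add: distrib_left distrib_right uu sc_left sc_right d_def scale_right_distrib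
          scale_left_distrib ac_simps)
    ultimately have "u + sc (\<tau> x) 1 = 0"
      using anisotropic[of "u + sc (\<tau> x) 1"] by (simp add: \<sigma>_add \<sigma>_sc \<sigma>u)
    then have "u = sc (\<tau> x) 1" by (simp add: add_eq_0_iff_eq)
    moreover have "u \<in> Alt_on UNIV" using uA by (auto simp: Alt_on_def)
    ultimately show False using sc_1_in_Alt u0 by auto
  qed
  define e where "e = sc (inverse d) z"
  have eQ: "e \<in> Q" and \<sigma>e: "\<sigma> e = e" using zQ \<sigma>z Qsc by (auto simp: e_def \<sigma>_sc)
  have eu: "e * u = u * e + u"
    using d by (simp add: e_def sc_left sc_right zu scale_right_distrib)
  have ind: "p = 0 \<and> q = 0 \<and> r = 0 \<and> t = 0"
    if "sc p 1 + sc q e + sc r u + sc t (u * e) = 0" for p q r t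
    using quaternion_basis_independent[OF uu a eu, of "sc p 1" "sc q 1" "sc r 1" "sc t 1"] that
    by (simp add: sc_left sc_right)
  let ?T = "{u * e, u, e, 1}"
  have T1: "independent {1::'a} \<and> finite {1::'a} \<and> card {1::'a} = 1" by simp
  have T2: "independent {e,1} \<and> finite {e,1} \<and> card {e,1} = Suc 1"
    using independent_insert_card[of "{1}" e] T1 ind[of _ 1 0 0]
    by (auto simp: span_breakdown_eq ac_simps)
  have "u \<notin> span {e, 1}"
  proof
    assume "u \<in> span {e, 1}"
    then obtain k l where "u + sc k e + sc l 1 = 0" by (auto simp: span_breakdown_eq)
    then show False using ind[of l k 1 0] by (simp add: ac_simps)
  qed
  then have T3: "independent {u,e,1} \<and> finite {u,e,1} \<and> card {u,e,1} = Suc (Suc 1)"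
    using independent_insert_card[of "{e,1}" u] T2 by auto
  have "u * e \<notin> span {u, e, 1}"
  proof
    assume "u * e \<in> span {u, e, 1}"
    then obtain k l m where "u * e + sc k u + sc l e + sc m 1 = 0" by (auto simp: span_breakdown_eq)
    then show False using ind[of m l k 1] by (simp add: ac_simps)
  qed
  then have T4: "independent ?T \<and> finite ?T \<and> card ?T = Suc (Suc (Suc 1))"
    using independent_insert_card[of "{u,e,1}" "u * e"] T3 by auto
  have Qspan: "Q \<subseteq> span ?T"
  proof
    fix y assume y: "y \<in> Q"
    show "y \<in> span ?T"
    proof (rule ccontr)
      assume "y \<notin> span ?T"
      then have 5: "independent (insert y ?T) \<and> card (insert y ?T) = 5"
        using independent_insert_card[of ?T y] T4 by auto
      then have "card (insert y ?T) \<le> 4"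
        by (intro independent_card_le[OF dim]) (use y eQ uQ Q1 Qmult in auto)
      then show False using 5 by simp
    qed
  qed
  \<comment> \<open>The element \<open>e * e + e\<close> commutes with \<open>e\<close> and
    \<open>u\<close>, hence with all of \<open>Q\<close>, so it is a scalar
    \<open>b\<close>.\<close>
  define m where "m = e * e + e"
  have eu': "e * (u * y) = u * (e * y) + u * y" for y
    using eu by (metis mult.assoc distrib_right)
  have mu: "m * u = u * m"
    by (simp add: m_def distrib_left distrib_right mult.assoc eu eu' ac_simps)
  have me: "m * e = e * m"
    by (simp add: m_def distrib_left distrib_right mult.assoc)
  have "subspace {y. m * y = y * m}"
    by (rule subspaceI) (simp_all add: sc_left sc_right distrib_left distrib_right)
  moreover have "m * (u * e) = u * e * m"
    using mu me by (metis mult.assoc)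
  ultimately have "span ?T \<subseteq> {y. m * y = y * m}"
    using mu me by (intro span_minimal) simp_all
  then have "m \<in> centralizer Q Q"
    using Qspan eQ Qadd Qmult by (auto simp: centralizer_def m_def)
  then obtain b where "e * e + e = sc b 1" using cen m_def by auto
  then have "e * e = e + sc b 1" by (metis add.commute add_self_left)
  moreover have "?T = {1, e, u, u * e}" by auto
  ultimately show thesis using that eQ uQ \<sigma>e \<sigma>u uu a eu Qspan by metis
qed

section \<open>Adapted triples, built one quaternion factor at a time\<close>

text \<open>\<open>S\<close> plays the role of \<open>F[u\<^sub>1,\<dots>,u\<^sub>m]\<close> and \<open>E\<close> that of the set of products of the \<open>e\<^sub>i\<close>, where
  the \<open>i\<close>-th quaternion factor is generated by \<open>e\<^sub>i\<close> and \<open>u\<^sub>i\<close>.\<close>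
definition adapted :: "'a set \<Rightarrow> 'a set \<Rightarrow> 'a set \<Rightarrow> bool" where
  "adapted B S E \<longleftrightarrow> subspace B \<and> 1 \<in> B \<and> \<sigma> ` B \<subseteq> B \<and>
     subspace S \<and> S \<subseteq> B \<and> (\<forall>s\<in>S. \<sigma> s = s \<and> (\<exists>c. s * s = sc c 1)) \<and>
     (\<forall>s\<in>S. \<forall>t\<in>S. s * t = t * s) \<and> (\<forall>s\<in>S. \<exists>c. s + sc c 1 \<in> Alt_on B) \<and>
     finite E \<and> E \<subseteq> B \<and> 1 \<in> E \<and> (\<forall>g\<in>E. \<sigma> g = g \<and> g * g \<in> B) \<and>
     B \<subseteq> span {s * g | s g. s \<in> S \<and> g \<in> E} \<and>
     (\<forall>c. (\<Sum>g\<in>E. sc (c g) (g * g)) \<in> Alt_on B \<longrightarrow> (\<forall>g\<in>E. c g = 0))"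

lemma adapted_subspace: "adapted B S E \<Longrightarrow> subspace B"
  unfolding adapted_def by (rule conjunct1)

text \<open>Base of the induction, the tensor product of no factors: \<open>\<sigma>\<close> fixes
  scalars, so \<open>Alt_on K\<close> is zero and the square of \<open>1\<close> is independent
  modulo it.\<close>

lemma adapted_scalars:
  defines "K \<equiv> range (\<lambda>c. sc c 1)"
  shows "adapted K K {1}"
proof -
  have K: "subspace K" "1 \<in> K"
    using subspace_span[of "{1}"] span_base[of 1 "{1}"] by (auto simp: K_def span_singleton)
  have "\<sigma> x = x" if "x \<in> K" for x using that by (auto simp: K_def \<sigma>_sc)
  moreover from this have "Alt_on K = {0}"
    using K by (auto simp: Alt_on_def intro!: exI[of _ 1])
  moreover have "\<exists>c. x * x = sc c 1" "\<exists>c. x + sc c 1 = 0" "x * y = y * x" if "x \<in> K" "y \<in> K" for x y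
    using that by (auto simp: K_def sc_left sc_right add_eq_0_iff_eq mult.commute)
  moreover have "K \<subseteq> span {s * g | s g. s \<in> K \<and> g \<in> {1}}"
    by (auto intro: span_base)
  ultimately show ?thesis
    using K by (auto simp: adapted_def)
qed

lemma span_mult_right:
  assumes "x \<in> span G" "\<And>g. g \<in> G \<Longrightarrow> g * y \<in> span H"
  shows "x * y \<in> span H"
proof -
  have "subspace {x. x * y \<in> span H}"
    by (rule subspaceI) (auto simp: distrib_right sc_left intro: span_zero span_add span_scale)
  then have "span G \<subseteq> {x. x * y \<in> span H}" using assms(2) by (intro span_minimal) auto
  then show ?thesis using assms(1) by auto
qed

text \<open>Elements of the enlarged algebra have unique coordinates in \<open>1\<close>,
  \<open>e\<close>, \<open>u\<close>, \<open>u * e\<close> over \<open>B\<close>, and the clauses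
  are checked on these. For the independence of squares, \<open>(g * e)^2 = g^2 e + b g^2\<close>
  has \<open>e\<close>-coordinate \<open>g^2\<close>, which reduces the claim to the old
  squares.\<close>

lemma adapted_step:
  assumes ad: "adapted B S E"
    and \<sigma>e: "\<sigma> e = e" and \<sigma>u: "\<sigma> u = u" and uu: "u * u = sc a 1" and a: "a \<noteq> 0"
    and ee: "e * e = e + sc b 1" and eu: "e * u = u * e + u"
    and Be: "\<And>y. y \<in> B \<Longrightarrow> e * y = y * e" and Bu: "\<And>y. y \<in> B \<Longrightarrow> u * y = y * u"
  shows "adapted {p + q * e + r * u + t * (u * e) | p q r t. p \<in> B \<and> q \<in> B \<and> r \<in> B \<and> t \<in> B}
     {s + t * u | s t. s \<in> S \<and> t \<in> S} (E \<union> (\<lambda>g. g * e) ` E)"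
proof -
  define h where "h p q r t = p + q * e + r * u + t * (u * e)" for p q r t
  define B2 where "B2 = {h p q r t | p q r t. p \<in> B \<and> q \<in> B \<and> r \<in> B \<and> t \<in> B}"
  define S2 where "S2 = {s + t * u | s t. s \<in> S \<and> t \<in> S}"
  define E2 where "E2 = E \<union> (\<lambda>g. g * e) ` E"
  have B: "subspace B" "1 \<in> B" "\<And>y. y \<in> B \<Longrightarrow> \<sigma> y \<in> B"
    and S: "subspace S" "S \<subseteq> B" "\<And>s. s \<in> S \<Longrightarrow> \<sigma> s = s" "\<And>s. s \<in> S \<Longrightarrow> \<exists>c. s * s = sc c 1"
      "\<And>s t. s \<in> S \<Longrightarrow> t \<in> S \<Longrightarrow> s * t = t * s" "\<And>s. s \<in> S \<Longrightarrow> \<exists>c. s + sc c 1 \<in> Alt_on B"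
    and E: "finite E" "E \<subseteq> B" "1 \<in> E" "\<And>g. g \<in> E \<Longrightarrow> \<sigma> g = g" "\<And>g. g \<in> E \<Longrightarrow> g * g \<in> B"
    and gen: "B \<subseteq> span {s * g | s g. s \<in> S \<and> g \<in> E}"
    and indep: "\<And>c g. (\<Sum>g\<in>E. sc (c g) (g * g)) \<in> Alt_on B \<Longrightarrow> g \<in> E \<Longrightarrow> c g = 0"
    using ad unfolding adapted_def by blast+
  have B0: "0 \<in> B" and Badd: "\<And>x y. x \<in> B \<Longrightarrow> y \<in> B \<Longrightarrow> x + y \<in> B" and Bsc: "\<And>c x. x \<in> B \<Longrightarrow> sc c x \<in> B"
    using B(1) by (auto simp: subspace_0 subspace_add subspace_scale)
  have S0: "0 \<in> S" and Sadd: "\<And>x y. x \<in> S \<Longrightarrow> y \<in> S \<Longrightarrow> x + y \<in> S" and Ssc: "\<And>c x. x \<in> S \<Longrightarrow> sc c x \<in> S"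
    using S(1) by (auto simp: subspace_0 subspace_add subspace_scale)
  have SB: "\<And>s. s \<in> S \<Longrightarrow> s \<in> B" and EB: "\<And>g. g \<in> E \<Longrightarrow> g \<in> B" using S(2) E(2) by auto
  have h_add: "h p q r t + h p' q' r' t' = h (p + p') (q + q') (r + r') (t + t')" for p q r t p' q' r' t'
    by (simp add: h_def distrib_right ac_simps)
  have h_sc: "sc c (h p q r t) = h (sc c p) (sc c q) (sc c r) (sc c t)" for c p q r t
    by (simp add: h_def scale_right_distrib sc_left)
  \<comment> \<open>Since \<open>\<sigma> (u * e) = e * u = u * e + u\<close>, the last coordinate
    also feeds into the \<open>u\<close>-coordinate, while the first two stay separate.\<close>
  have h_\<sigma>: "\<sigma> (h p q r t) = h (\<sigma> p) (\<sigma> q) (\<sigma> r + \<sigma> t) (\<sigma> t)"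
    if "p \<in> B" "q \<in> B" "r \<in> B" "t \<in> B" for p q r t
  proof -
    have "e * u * \<sigma> t = \<sigma> t * (u * e) + \<sigma> t * u"
      using Be[OF B(3)[OF that(4)]] Bu[OF B(3)[OF that(4)]] eu
      by (metis distrib_left mult.assoc)
    then show ?thesis
      using Be[OF B(3)[OF that(2)]] Bu[OF B(3)[OF that(3)]]
      by (simp add: h_def \<sigma>_add \<sigma>_mult \<sigma>e \<sigma>u distrib_right add.assoc)
  qed
  have h_0: "p = 0 \<and> q = 0 \<and> r = 0 \<and> t = 0"
    if "h p q r t = 0" "p \<in> B" "q \<in> B" "r \<in> B" "t \<in> B" for p q r t
    using quaternion_basis_independent[OF uu a eu, of p q r t] that(1)
      Be[OF that(2)] Be[OF that(3)] Be[OF that(4)] Be[OF that(5)]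
      Bu[OF that(2)] Bu[OF that(3)] Bu[OF that(4)] Bu[OF that(5)] by (simp add: h_def)
  have h_inj: "p = p' \<and> q = q'"
    if "h p q 0 0 = h p' q' r t" "p \<in> B" "q \<in> B" "p' \<in> B" "q' \<in> B" "r \<in> B" "t \<in> B" for p q p' q' r t
  proof -
    have "h (p + p') (q + q') r t = 0"
      using h_add[of p q 0 0 p' q' r t] that(1) by simp
    from h_0[OF this] show ?thesis using that Badd by (simp add: add_eq_0_iff_eq)
  qed
  have h_B2: "h p q r t \<in> B2" if "p \<in> B" "q \<in> B" "r \<in> B" "t \<in> B" for p q r t
    using that by (auto simp: B2_def)
  have subB2: "subspace B2"
  proof (rule subspaceI)
    show "0 \<in> B2" using h_B2[OF B0 B0 B0 B0] by (simp add: h_def)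
  next
    fix x y assume "x \<in> B2" "y \<in> B2"
    then show "x + y \<in> B2" using Badd h_B2 by (auto simp: B2_def[THEN eqset_imp_iff, of x] B2_def[THEN eqset_imp_iff, of y] h_add)
  next
    fix c x assume "x \<in> B2"
    then show "sc c x \<in> B2" using Bsc h_B2 by (auto simp: B2_def[THEN eqset_imp_iff, of x] h_sc)
  qed
  have B2\<sigma>: "\<sigma> ` B2 \<subseteq> B2"
  proof
    fix x assume "x \<in> \<sigma> ` B2"
    then obtain p q r t where "p \<in> B" "q \<in> B" "r \<in> B" "t \<in> B" "x = \<sigma> (h p q r t)"
      by (auto simp: B2_def)
    then show "x \<in> B2" using h_\<sigma> h_B2 Badd B(3) by simp
  qed
  have subS2: "subspace S2"
  proof (rule subspaceI)
    show "0 \<in> S2" using S0 by (auto simp: S2_def intro!: exI[of _ 0])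
  next
    fix x y assume "x \<in> S2" "y \<in> S2"
    then obtain s t s' t' where "s \<in> S" "t \<in> S" "s' \<in> S" "t' \<in> S" "x = s + t * u" "y = s' + t' * u"
      by (auto simp: S2_def)
    then have "x + y = (s + s') + (t + t') * u" "s + s' \<in> S" "t + t' \<in> S"
      using Sadd by (auto simp: distrib_right ac_simps)
    then show "x + y \<in> S2" by (auto simp: S2_def)
  next
    fix c x assume "x \<in> S2"
    then obtain s t where "s \<in> S" "t \<in> S" "x = s + t * u" by (auto simp: S2_def)
    then have "sc c x = sc c s + sc c t * u" "sc c s \<in> S" "sc c t \<in> S"
      using Ssc by (auto simp: scale_right_distrib sc_left)
    then show "sc c x \<in> S2" by (auto simp: S2_def)
  qed
  have S2B2: "S2 \<subseteq> B2"
  proof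
    fix x assume "x \<in> S2"
    then obtain s t where "s \<in> S" "t \<in> S" "x = s + t * u" by (auto simp: S2_def)
    then show "x \<in> B2" using h_B2[of s 0 t 0] B0 SB by (auto simp: h_def)
  qed
  have S2prod: "(s + t * u) * (s' + t' * u) = s * s' + sc a (t * t') + (s * t' + t * s') * u"
    if "s \<in> S" "t \<in> S" "s' \<in> S" "t' \<in> S" for s t s' t'
  proof -
    have 1: "t * u * s' = t * s' * u"
      using Bu[OF SB[OF that(3)]] by (simp add: mult.assoc)
    have "t * u * (t' * u) = t * t' * (u * u)"
      using Bu[OF SB[OF that(4)]] by (metis mult.assoc)
    then have 2: "t * u * (t' * u) = sc a (t * t')" by (simp add: uu sc_right)
    have 3: "s * (t' * u) = s * t' * u" by (simp add: mult.assoc)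
    show ?thesis
      by (simp add: distrib_left distrib_right 1 2 3 add.assoc add.commute add.left_commute)
  qed
  have S2sym: "\<forall>x\<in>S2. \<sigma> x = x \<and> (\<exists>c. x * x = sc c 1)"
  proof
    fix x assume "x \<in> S2"
    then obtain s t where st: "s \<in> S" "t \<in> S" "x = s + t * u" by (auto simp: S2_def)
    obtain c d where "s * s = sc c 1" "t * t = sc d 1" using S(4) st by metis
    then have "x * x = sc (c + a * d) 1"
      using S2prod[of s t s t] st S(5)[OF st(1,2)] by (simp add: scale_left_distrib)
    moreover have "\<sigma> x = x" using st S(3) Bu[OF SB[OF st(2)]] by (simp add: \<sigma>_add \<sigma>_mult \<sigma>u)
    ultimately show "\<sigma> x = x \<and> (\<exists>c. x * x = sc c 1)" by blast
  qed
  have S2comm: "\<forall>x\<in>S2. \<forall>y\<in>S2. x * y = y * x"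
  proof (intro ballI)
    fix x y assume "x \<in> S2" "y \<in> S2"
    then obtain s t s' t' where st: "s \<in> S" "t \<in> S" "s' \<in> S" "t' \<in> S" "x = s + t * u" "y = s' + t' * u"
      by (auto simp: S2_def)
    have "s * s' = s' * s" "t * t' = t' * t" "s * t' + t * s' = s' * t + t' * s"
      using st S(5) by (simp_all add: add.commute)
    then show "x * y = y * x"
      using S2prod[OF st(1-4)] S2prod[OF st(3,4,1,2)] st(5,6) by metis
  qed
  have S2Alt: "\<forall>x\<in>S2. \<exists>c. x + sc c 1 \<in> Alt_on B2"
  proof
    fix x assume "x \<in> S2"
    then obtain s t where st: "s \<in> S" "t \<in> S" "x = s + t * u" by (auto simp: S2_def)
    obtain c d y z where y: "y \<in> B" "s + sc c 1 = y + \<sigma> y" and z: "z \<in> B" "t + sc d 1 = z + \<sigma> z"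
      using S(6)[OF st(1)] S(6)[OF st(2)] by (auto simp: Alt_on_def)
    \<comment> \<open>The term \<open>z * u\<close> contributes only
      \<open>(z + \<sigma> z) * u\<close>, which is \<open>t * u + sc d u\<close>. As
      \<open>u * e + \<sigma> (u * e) = u\<close>, the last coordinate \<open>sc d 1\<close> cancels
      the surplus \<open>sc d u\<close>.\<close>
    let ?w = "h y 0 z (sc d 1)"
    have t: "t = z + \<sigma> z + sc d 1" using z(2) by (metis add.assoc add_self add.right_neutral)
    have "?w + \<sigma> ?w = h (y + \<sigma> y) 0 t 0"
      using y z B0 Bsc[OF B(2)] by (simp add: h_\<sigma> h_add \<sigma>_sc t ac_simps)
    also have "\<dots> = x + sc c 1" by (simp add: h_def st(3) ac_simps flip: y(2))
    finally show "\<exists>c. x + sc c 1 \<in> Alt_on B2"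
      using Alt_onI[OF h_B2[of y 0 z "sc d 1"]] y z B0 Bsc[OF B(2)] by metis
  qed
  have E2B2: "E2 \<subseteq> B2"
  proof
    fix x assume "x \<in> E2"
    then consider "x \<in> E" | g where "g \<in> E" "x = g * e" by (auto simp: E2_def)
    then show "x \<in> B2"
    proof cases
      case 1
      then show ?thesis using h_B2[of x 0 0 0] EB B0 by (simp add: h_def)
    next
      case (2 g)
      then show ?thesis using h_B2[of 0 g 0 0] EB B0 by (simp add: h_def)
    qed
  qed
  have sq: "(g * e) * (g * e) = h (sc b (g * g)) (g * g) 0 0" if "g \<in> E" for g
  proof -
    have "(g * e) * (g * e) = g * g * (e * e)" using Be[OF EB[OF that]] by (metis mult.assoc)
    then show ?thesis by (simp add: ee distrib_left sc_right h_def ac_simps)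
  qed
  have E2sym: "\<forall>x\<in>E2. \<sigma> x = x \<and> x * x \<in> B2"
  proof
    fix x assume "x \<in> E2"
    then consider "x \<in> E" | g where "g \<in> E" "x = g * e" by (auto simp: E2_def)
    then show "\<sigma> x = x \<and> x * x \<in> B2"
    proof cases
      case 1
      then show ?thesis using h_B2[of "x * x" 0 0 0] E B0 by (simp add: h_def)
    next
      case (2 g)
      then show ?thesis using h_B2[of "sc b (g * g)" "g * g" 0 0] E B0 Bsc sq Be[OF EB[OF 2(1)]]
        by (simp add: \<sigma>_mult \<sigma>e)
    qed
  qed
  let ?G = "{s * g | s g. s \<in> S \<and> g \<in> E}" and ?G2 = "{s * g | s g. s \<in> S2 \<and> g \<in> E2}"
  have S2I: "s \<in> S2" "s * u \<in> S2" if "s \<in> S" for s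
    using that S0 by (force simp: S2_def)+
  have G2: "s * g \<in> span ?G2" "s * g * e \<in> span ?G2" "s * g * u \<in> span ?G2" "s * g * (u * e) \<in> span ?G2"
    if "s \<in> S" "g \<in> E" for s g
  proof -
    have g: "g \<in> E2" "g * e \<in> E2" using that by (auto simp: E2_def)
    have c: "s * g * u = (s * u) * g" "s * g * (u * e) = (s * u) * (g * e)"
      using Bu[OF EB[OF that(2)]] by (metis mult.assoc)+
    show "s * g \<in> span ?G2" "s * g * e \<in> span ?G2" "s * g * u \<in> span ?G2" "s * g * (u * e) \<in> span ?G2"
      unfolding c mult.assoc[of s g e] using S2I[OF that(1)] g by (blast intro: span_base)+
  qed
  have gen2: "B2 \<subseteq> span ?G2"
  proof -
    have "p * y \<in> span ?G2" if "p \<in> B" "y \<in> {1, e, u, u * e}" for p y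
      by (rule span_mult_right[of p ?G]) (use gen that G2 in auto)
    from this[of _ 1] this[of _ e] this[of _ u] this[of _ "u * e"] show ?thesis
      by (auto simp: B2_def h_def intro!: span_add)
  qed
  \<comment> \<open>A zero in \<open>E\<close> could carry any coefficient, so the indicator
    function of 0 would violate independence. This is used for the disjointness of \<open>E\<close>
    and its translate by \<open>e\<close>.\<close>
  have E0: "0 \<notin> E"
  proof
    assume "0 \<in> E"
    moreover have "(\<Sum>g\<in>E. sc (if g = 0 then 1 else 0) (g * g)) = 0" by (rule sum.neutral) auto
    ultimately show False
      using indep[of "\<lambda>g. if g = 0 then 1 else 0" 0] subspace_0[OF subspace_Alt_on[OF B(1)]] by simp
  qed
  have inj: "inj_on (\<lambda>g. g * e) E"
  proof (rule inj_onI)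
    fix g g' assume *: "g \<in> E" "g' \<in> E" "g * e = g' * e"
    then show "g = g'" using h_inj[of 0 g 0 g' 0 0] EB B0 by (simp add: h_def)
  qed
  have disj: "E \<inter> (\<lambda>g. g * e) ` E = {}"
  proof -
    have False if "g \<in> E" "g' \<in> E" "g = g' * e" for g g'
      using h_inj[of g 0 0 g' 0 0] that EB B0 E0 by (auto simp: h_def)
    then show ?thesis by blast
  qed
  have indep2: "\<forall>x\<in>E2. c x = 0" if c: "(\<Sum>x\<in>E2. sc (c x) (x * x)) \<in> Alt_on B2" for c
  proof -
    \<comment> \<open>By the formula for \<open>(g * e)^2\<close> the given sum equals
      \<open>P + R * e\<close>, with the \<open>b\<close>-contributions collected in
      \<open>P\<close>.\<close>
    define P where "P = (\<Sum>g\<in>E. sc (c g + b * c (g * e)) (g * g))"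
    define R where "R = (\<Sum>g\<in>E. sc (c (g * e)) (g * g))"
    have PR: "P \<in> B" "R \<in> B"
      unfolding P_def R_def using E(5) B(1) by (auto intro!: subspace_sum subspace_scale)
    have "(\<Sum>x\<in>E2. sc (c x) (x * x))
        = (\<Sum>g\<in>E. sc (c g) (g * g)) + (\<Sum>g\<in>E. sc (c (g * e)) ((g * e) * (g * e)))"
      unfolding E2_def using E(1) disj inj by (simp add: sum.union_disjoint sum.reindex)
    also have "(\<Sum>g\<in>E. sc (c (g * e)) ((g * e) * (g * e)))
        = (\<Sum>g\<in>E. sc (b * c (g * e)) (g * g)) + R * e"
      unfolding R_def sum_distrib_right sum.distrib[symmetric]
      by (rule sum.cong) (auto simp: sq h_def scale_right_distrib sc_left mult.commute)
    also have "(\<Sum>g\<in>E. sc (c g) (g * g)) + ((\<Sum>g\<in>E. sc (b * c (g * e)) (g * g)) + R * e) = h P R 0 0"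
      by (simp add: P_def h_def scale_left_distrib sum.distrib add.assoc)
    finally have "h P R 0 0 \<in> Alt_on B2" using c by simp
    then obtain p q r t where y: "p \<in> B" "q \<in> B" "r \<in> B" "t \<in> B"
      "h P R 0 0 = h p q r t + \<sigma> (h p q r t)"
      by (auto simp: Alt_on_def B2_def)
    then have "h P R 0 0 = h (p + \<sigma> p) (q + \<sigma> q) (r + (\<sigma> r + \<sigma> t)) (t + \<sigma> t)"
      by (simp add: h_\<sigma> h_add)
    from h_inj[OF this] have "P = p + \<sigma> p" "R = q + \<sigma> q" using y PR Badd B(3) by auto
    then have PR_Alt: "P \<in> Alt_on B" "R \<in> Alt_on B" using y Alt_onI by auto
    \<comment> \<open>The relation from \<open>R\<close> comes first: once \<open>c (g * e)\<close>
      vanishes, the mixed coefficients of \<open>P\<close> reduce to \<open>c g\<close>.\<close>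
    have 1: "c (g * e) = 0" if "g \<in> E" for g
      by (rule indep[OF PR_Alt(2)[unfolded R_def] that])
    have "c g + b * c (g * e) = 0" if "g \<in> E" for g
      by (rule indep[OF PR_Alt(1)[unfolded P_def] that])
    then have "c g = 0" if "g \<in> E" for g using 1 that by simp
    with 1 show ?thesis by (auto simp: E2_def)
  qed
  have base: "1 \<in> B2" "finite E2" "1 \<in> E2"
    using E h_B2[of 1 0 0 0] B B0 by (auto simp: h_def E2_def)
  have "adapted B2 S2 E2"
    unfolding adapted_def
  proof (intro conjI allI impI)
  qed (rule subB2 B2\<sigma> subS2 S2B2 S2sym S2comm S2Alt E2B2 E2sym gen2 base | erule indep2)+
  then show ?thesis unfolding B2_def S2_def E2_def h_def .
qed

text \<open>Induction on the list of factors through \<open>adapted_step\<close>. The clause on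
  commuting elements is carried along so that \<open>B\<close>, built from the remaining factors, is
  known to commute with the factor being adjoined.\<close>

lemma adapted_of_quaternions:
  assumes "\<forall>Q\<in>set Qs. quaternion_subalg sc Q \<and> \<sigma> ` Q \<subseteq> Q"
    and "\<And>i j x y. i < length Qs \<Longrightarrow> j < length Qs \<Longrightarrow> i \<noteq> j \<Longrightarrow> x \<in> Qs ! i \<Longrightarrow> y \<in> Qs ! j \<Longrightarrow> x * y = y * x"
  shows "\<exists>B S E. adapted B S E \<and> {prod_list xs | xs. list_all2 (\<in>) xs Qs} \<subseteq> B \<and>
    (\<forall>z. (\<forall>Q\<in>set Qs. \<forall>x\<in>Q. z * x = x * z) \<longrightarrow> (\<forall>y\<in>B. z * y = y * z))"
  using assms
proof (induction Qs)
  case Nil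
  show ?case
    using adapted_scalars
    by (intro exI[of _ "range (\<lambda>c. sc c 1)"] exI[of _ "{1}"])
       (auto simp: sc_left sc_right intro: range_eqI[of _ _ "1::'f"])
next
  case (Cons Q Qs)
  have comm': "x * y = y * x" if "i < length Qs" "j < length Qs" "i \<noteq> j" "x \<in> Qs ! i" "y \<in> Qs ! j" for i j x y
    using Cons.prems(2)[of "Suc i" "Suc j" x y] that by simp
  have "\<forall>Q\<in>set Qs. quaternion_subalg sc Q \<and> \<sigma> ` Q \<subseteq> Q" using Cons.prems(1) by simp
  then have "\<exists>B S E. adapted B S E \<and> {prod_list xs | xs. list_all2 (\<in>) xs Qs} \<subseteq> B \<and>
      (\<forall>z. (\<forall>Q\<in>set Qs. \<forall>x\<in>Q. z * x = x * z) \<longrightarrow> (\<forall>y\<in>B. z * y = y * z))"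
    by (rule Cons.IH) (rule comm')
  then obtain B S E where ad: "adapted B S E"
    and prods: "{prod_list xs | xs. list_all2 (\<in>) xs Qs} \<subseteq> B"
    and comm: "\<forall>z. (\<forall>Q\<in>set Qs. \<forall>x\<in>Q. z * x = x * z) \<longrightarrow> (\<forall>y\<in>B. z * y = y * z)"
    by (elim exE conjE) (rule that)
  have QB: "z * y = y * z" if "z \<in> Q" "y \<in> B" for z y
  proof (rule comm[rule_format, OF _ that(2)])
    fix Q' x assume "Q' \<in> set Qs" "x \<in> Q'"
    then obtain k where "k < length Qs" "Q' = Qs ! k" by (auto simp: in_set_conv_nth)
    then show "z * x = x * z" using Cons.prems(2)[of 0 "Suc k" z x] that(1) \<open>x \<in> Q'\<close> by simp
  qed
  have "quaternion_subalg sc Q" "\<sigma> ` Q \<subseteq> Q" using Cons.prems(1) by auto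
  from quaternion_presentation[OF this] obtain e u a b where e: "e \<in> Q" and u: "u \<in> Q"
    and pres: "\<sigma> e = e" "\<sigma> u = u" "u * u = sc a 1" "a \<noteq> 0" "e * e = e + sc b 1" "e * u = u * e + u"
    and Q: "Q \<subseteq> span {1, e, u, u * e}" by metis
  let ?B2 = "{p + q * e + r * u + t * (u * e) | p q r t. p \<in> B \<and> q \<in> B \<and> r \<in> B \<and> t \<in> B}"
  have ad2: "adapted ?B2 {s + t * u | s t. s \<in> S \<and> t \<in> S} (E \<union> (\<lambda>g. g * e) ` E)"
    by (rule adapted_step[OF ad pres]) (simp_all only: QB e u)
  have subB: "subspace B" and subB2: "subspace ?B2" using ad ad2 by (blast dest: adapted_subspace)+
  have "prod_list xs \<in> ?B2" if xs: "list_all2 (\<in>) xs (Q # Qs)" for xs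
  proof -
    obtain x ys where x: "xs = x # ys" "x \<in> Q" and ys: "prod_list ys \<in> B"
      using xs prods by (auto simp: list_all2_Cons2)
    let ?y = "prod_list ys"
    \<comment> \<open>As an element of \<open>B\<close>, \<open>?y\<close> commutes with
      \<open>e\<close> and \<open>u\<close>, so it moves to the front as the coefficient of
      \<open>g\<close>; the other three coefficients are 0.\<close>
    have gens: "g * ?y \<in> ?B2" if g: "g \<in> {1, e, u, u * e}" for g
    proof -
      have "(if g = w then ?y else 0) \<in> B" for w using ys subspace_0[OF subB] by simp
      moreover have "e * ?y = ?y * e" "u * ?y = ?y * u" "u * e * ?y = ?y * (u * e)"
        using QB[OF e ys] QB[OF u ys] by (auto simp: mult.assoc) (metis mult.assoc)
      then have "g * ?y = ?y \<or> g * ?y = ?y * e \<or> g * ?y = ?y * u \<or> g * ?y = ?y * (u * e)"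
        using g by auto
      then have "\<exists>p\<in>{0,?y}. \<exists>q\<in>{0,?y}. \<exists>r\<in>{0,?y}. \<exists>t\<in>{0,?y}. g * ?y = p + q * e + r * u + t * (u * e)"
        by auto
      ultimately show ?thesis using ys subspace_0[OF subB] by blast
    qed
    have "subspace {z. z * ?y \<in> ?B2}"
    proof (rule subspaceI; unfold mem_Collect_eq[of _ "\<lambda>z. z * ?y \<in> ?B2"])
      show "0 * ?y \<in> ?B2" using subspace_0[OF subB2] by (simp only: mult_zero_left)
    next
      fix v w assume "v * ?y \<in> ?B2" "w * ?y \<in> ?B2"
      then show "(v + w) * ?y \<in> ?B2" unfolding distrib_right[of v w] by (rule subspace_add[OF subB2])
    next
      fix c v assume "v * ?y \<in> ?B2"
      then show "sc c v * ?y \<in> ?B2" unfolding sc_left by (rule subspace_scale[OF subB2])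
    qed
    then have "span {1, e, u, u * e} \<subseteq> {z. z * ?y \<in> ?B2}"
      using gens by (intro span_minimal) blast
    then show ?thesis using Q x by auto
  qed
  moreover have "\<forall>y\<in>?B2. z * y = y * z" if z: "\<forall>Q'\<in>set (Q # Qs). \<forall>x\<in>Q'. z * x = x * z" for z
  proof -
    have zB: "z * y = y * z" if "y \<in> B" for y
      using comm[rule_format, OF _ that] z by simp
    have ze: "z * e = e * z" "z * u = u * z" using z e u by auto
    have "z * (p * w) = p * w * z" if "p \<in> B" "w = e \<or> w = u \<or> w = u * e" for p w
    proof -
      have "z * w = w * z" using that(2) ze by (metis mult.assoc)
      then show ?thesis using zB[OF that(1)] by (metis mult.assoc)
    qed
    then show ?thesis using zB by (auto simp: distrib_left[of z] distrib_right[of _ _ z])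
  qed
  ultimately show ?case
    by (intro exI conjI) (rule ad2, blast+)
qed

section \<open>Locating the symmetric elements with scalar square\<close>

lemma span_products_sum:
  assumes "finite E" "subspace S" "x \<in> span {s * g | s g. s \<in> S \<and> g \<in> E}"
  obtains f where "\<And>g. g \<in> E \<Longrightarrow> f g \<in> S" "x = (\<Sum>g\<in>E. f g * g)"
proof -
  let ?T = "{x. \<exists>f. (\<forall>g\<in>E. f g \<in> S) \<and> x = (\<Sum>g\<in>E. f g * g)}"
  have "subspace ?T"
  proof (rule subspaceI)
    show "0 \<in> ?T" using subspace_0[OF assms(2)] by (auto intro!: exI[of _ "\<lambda>_. 0"])
  next
    fix x y assume "x \<in> ?T" "y \<in> ?T"
    then obtain f f' where "\<forall>g\<in>E. f g \<in> S" "\<forall>g\<in>E. f' g \<in> S"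
      "x = (\<Sum>g\<in>E. f g * g)" "y = (\<Sum>g\<in>E. f' g * g)" by auto
    then show "x + y \<in> ?T" using assms(2)
      by (auto intro!: exI[of _ "\<lambda>g. f g + f' g"] subspace_add simp: distrib_right sum.distrib)
  next
    fix c x assume "x \<in> ?T"
    then obtain f where "\<forall>g\<in>E. f g \<in> S" "x = (\<Sum>g\<in>E. f g * g)" by auto
    then show "sc c x \<in> ?T" using assms(2)
      by (auto intro!: exI[of _ "\<lambda>g. sc c (f g)"] subspace_scale simp: sc_left scale_sum_right)
  qed
  moreover have "s * g \<in> ?T" if "s \<in> S" "g \<in> E" for s g
  proof -
    have "(\<Sum>g'\<in>E. (if g' = g then s else 0) * g') = (\<Sum>g'\<in>E. if g' = g then s * g' else 0)"
      by (rule sum.cong) auto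
    also have "\<dots> = s * g" using assms(1) that by (simp add: sum.delta)
    finally show ?thesis
      using that subspace_0[OF assms(2)] by (auto intro!: exI[of _ "\<lambda>g'. if g' = g then s else 0"])
  qed
  ultimately have "span {s * g | s g. s \<in> S \<and> g \<in> E} \<subseteq> ?T" by (intro span_minimal) auto
  then show thesis using that assms(3) by blast
qed

text \<open>For \<open>x\<close> symmetric with square \<open>k\<close>, the norm
  \<open>\<sigma> x * x\<close> is the scalar \<open>k\<close>. Expanding \<open>x\<close> over
  \<open>E\<close> with coefficients in \<open>S\<close> turns this into a relation between the
  squares of \<open>E\<close> modulo alternating elements, and independence leaves only the term at
  \<open>1\<close>.\<close>

lemma Sym_plus_subset_adapted:
  assumes ad: "adapted UNIV S E"
  shows "Sym_plus sc \<sigma> \<subseteq> S"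
proof
  fix x assume "x \<in> Sym_plus sc \<sigma>"
  then obtain k where \<sigma>x: "\<sigma> x = x" and xx: "x * x = sc k 1" by (auto simp: Sym_plus_def)
  have S: "subspace S" "\<And>s. s \<in> S \<Longrightarrow> \<sigma> s = s" "\<And>s. s \<in> S \<Longrightarrow> \<exists>c. s * s = sc c 1"
    and E: "finite E" "1 \<in> E" "\<And>g. g \<in> E \<Longrightarrow> \<sigma> g = g"
    and gen: "UNIV \<subseteq> span {s * g | s g. s \<in> S \<and> g \<in> E}"
    and indep: "\<And>c g. (\<Sum>g\<in>E. sc (c g) (g * g)) \<in> Alt_on UNIV \<Longrightarrow> g \<in> E \<Longrightarrow> c g = 0"
    using ad unfolding adapted_def by blast+
  obtain f where f: "\<And>g. g \<in> E \<Longrightarrow> f g \<in> S" "x = (\<Sum>g\<in>E. f g * g)"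
    using span_products_sum[OF E(1) S(1)] gen by blast
  have "\<forall>g\<in>E. \<exists>c. f g * f g = sc c 1" using f(1) S(3) by blast
  then obtain q where q: "\<And>g. g \<in> E \<Longrightarrow> f g * f g = sc (q g) 1" by metis
  have "\<sigma> (f g * g) * (f g * g) = sc (q g) (g * g)" if "g \<in> E" for g
  proof -
    have "\<sigma> (f g * g) * (f g * g) = g * (f g * f g) * g"
      using that S(2) f(1) E(3) by (simp add: \<sigma>_mult mult.assoc)
    then show ?thesis using q[OF that] by (simp add: sc_left sc_right)
  qed
  then have "sc k 1 + (\<Sum>g\<in>E. sc (q g) (g * g)) \<in> Alt_on UNIV"
    using norm_sum_mod_Alt[OF E(1), of "\<lambda>g. f g * g"] \<sigma>x xx by (simp flip: f(2))
  \<comment> \<open>Because \<open>1\<close> belongs to \<open>E\<close> and is its own square,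
    \<open>k\<close> is absorbed into the coefficient at \<open>g = 1\<close>; the other
    coefficients remain \<open>q g\<close>.\<close>
  also have "sc k 1 + (\<Sum>g\<in>E. sc (q g) (g * g))
      = (\<Sum>g\<in>E. sc ((if g = 1 then k else 0) + q g) (g * g))"
  proof -
    have "(\<Sum>g\<in>E. sc (if g = 1 then k else 0) (g * g)) = (\<Sum>g\<in>E. if g = 1 then sc k 1 else 0)"
      by (rule sum.cong) auto
    also have "\<dots> = sc k 1" using E by (simp add: sum.delta)
    finally show ?thesis by (simp add: scale_left_distrib sum.distrib)
  qed
  finally have "(if g = 1 then k else 0) + q g = 0" if "g \<in> E" for g
    using indep[of "\<lambda>g. (if g = 1 then k else 0) + q g"] that by blast
  then have "q g = 0" if "g \<in> E" "g \<noteq> 1" for g using that by fastforce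
  \<comment> \<open>Here \<open>f g\<close> is symmetric and its square is
    \<open>sc (q g) 1 = 0\<close>, so anisotropy applies.\<close>
  then have f0: "f g = 0" if "g \<in> E" "g \<noteq> 1" for g
    using that q S(2) f(1) anisotropic[of "f g"] by simp
  have "x = (\<Sum>g\<in>E. if g = 1 then f 1 else 0)"
    unfolding f(2) by (rule sum.cong) (auto simp: f0)
  then have "x = f 1" using E by (simp add: sum.delta)
  then show "x \<in> S" using f(1) E by simp
qed

end

section \<open>Decomposition, maximality and uniqueness of the inseparable subalgebra\<close>

theorem theorem3p5:
  fixes sc :: "'f::field \<Rightarrow> 'a::ring_1 \<Rightarrow> 'a" and \<sigma> :: "'a \<Rightarrow> 'a" and n :: nat and S :: "'a set"
  assumes char2: "(2::'f) = 0"
    and csa: "central_simple_algebra sc"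
    and deg: "vector_space.dim sc (UNIV::'a set) = (2 ^ n) ^ 2"
    and inv: "involution_first_kind sc \<sigma>"
    and orth: "orthogonal_char2 \<sigma>"
    and aniso: "anisotropic \<sigma>"
    and td: "totally_decomposable sc \<sigma>"
    and insep: "inseparable_subalg sc \<sigma> n S"
  shows "S = {x + sc c 1 | x c. x \<in> Alt_plus sc \<sigma>}
     \<and> Alt_plus sc \<sigma> \<inter> range (\<lambda>c. sc c 1) = {0}
     \<and> S = Sym_plus sc \<sigma>
     \<and> maximal_subfield sc S
     \<and> (\<forall>S'. inseparable_subalg sc \<sigma> n S' \<longrightarrow> S' = S)"
proof -
  have "F_algebra sc" using csa by (simp add: central_simple_algebra_def)
  then have vs: "vector_space sc"
    and sc_mult: "\<forall>c x y. sc c (x * y) = sc c x * y \<and> sc c (x * y) = x * sc c y"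
    unfolding F_algebra_def by (rule conjunct1, rule conjunct2)
  have involution: "\<forall>x y. \<sigma> (x + y) = \<sigma> x + \<sigma> y" "\<forall>x y. \<sigma> (x * y) = \<sigma> y * \<sigma> x"
    "\<forall>x. \<sigma> (\<sigma> x) = x" "\<forall>c x. \<sigma> (sc c x) = sc c (\<sigma> x)"
    using inv unfolding involution_first_kind_def by blast+
  interpret vector_space sc by (rule vs)
  interpret char2_involution sc \<sigma>
  proof
    show "(2::'f) = 0" by (rule char2)
    show "sc c x * y = sc c (x * y)" "x * sc c y = sc c (x * y)" for c x y
      by (simp_all only: sc_mult[rule_format, THEN conjunct1, symmetric]
          sc_mult[rule_format, THEN conjunct2, symmetric])
  qed (use involution in blast)+
  interpret anisotropic_orthogonal sc \<sigma>
  proof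
    show "1 \<notin> Alt_on UNIV" using orth by (simp add: Alt_on_UNIV orthogonal_char2_def)
    show "x = 0" if "\<sigma> x * x = 0" for x using aniso that unfolding anisotropic_def by blast
  qed
  from td[unfolded totally_decomposable_def] obtain Qs
    where Qs: "\<forall>Q\<in>set Qs. quaternion_subalg sc Q \<and> \<sigma> ` Q \<subseteq> Q"
    and comm: "\<forall>i j. i < length Qs \<and> j < length Qs \<and> i \<noteq> j \<longrightarrow> (\<forall>x\<in>Qs!i. \<forall>y\<in>Qs!j. x * y = y * x)"
    and gen: "span {prod_list xs | xs. list_all2 (\<in>) xs Qs} = UNIV"
    by (elim exE conjE) (rule that)
  obtain B S0 E where ad: "adapted B S0 E" and prods: "{prod_list xs | xs. list_all2 (\<in>) xs Qs} \<subseteq> B"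
  proof -
    have "\<exists>B S E. adapted B S E \<and> {prod_list xs | xs. list_all2 (\<in>) xs Qs} \<subseteq> B \<and>
      (\<forall>z. (\<forall>Q\<in>set Qs. \<forall>x\<in>Q. z * x = x * z) \<longrightarrow> (\<forall>y\<in>B. z * y = y * z))"
      by (rule adapted_of_quaternions[OF Qs]) (rule comm[rule_format], simp)
    then show thesis by (elim exE conjE) (rule that)
  qed
  \<comment> \<open>The spanning clause of total decomposability enters here: \<open>B\<close> is a
    subspace containing all products of elements of the factors.\<close>
  have "B = UNIV"
    using span_minimal[OF prods adapted_subspace[OF ad]] gen by auto
  with ad have ad: "adapted UNIV S0 E" by simp
  have Sym_S0: "Sym_plus sc \<sigma> \<subseteq> S0" by (rule Sym_plus_subset_adapted[OF ad])
  have S0_comm: "\<And>x y. x \<in> S0 \<Longrightarrow> y \<in> S0 \<Longrightarrow> x * y = y * x"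
    and S0_sq: "\<And>x. x \<in> S0 \<Longrightarrow> \<sigma> x = x \<and> (\<exists>c. x * x = sc c 1)"
    and S0_Alt: "\<And>x. x \<in> S0 \<Longrightarrow> \<exists>c. x + sc c 1 \<in> Alt \<sigma>"
    using ad unfolding adapted_def Alt_on_UNIV by blast+
  have insep_eq: "S' = S0" if "inseparable_subalg sc \<sigma> n S'" for S'
  proof -
    have S': "S' \<subseteq> S0" and cent: "centralizer UNIV S' = S'"
      using that Sym_S0 by (auto simp: inseparable_subalg_def)
    have "S0 \<subseteq> centralizer UNIV S'"
      using S0_comm S' by (auto simp: centralizer_def)
    then show ?thesis using S' cent by blast
  qed
  have S: "S = S0" by (rule insep_eq[OF insep])
  have alg: "subalg sc S" and cent: "centralizer UNIV S = S"
    using insep by (auto simp: inseparable_subalg_def)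
  have S_sc: "sc c x \<in> S" and S_add: "x + y \<in> S" if "x \<in> S" "y \<in> S" for c x y
    using alg that by (auto simp: subalg_def)
  have one_S: "1 \<in> S" using alg by (simp add: subalg_def)
  have Sym: "S = Sym_plus sc \<sigma>"
    using S Sym_S0 S0_sq by (auto simp: Sym_plus_def)
  have Alt_Sym: "Alt_plus sc \<sigma> \<subseteq> S"
    unfolding Sym by (auto simp: Alt_plus_def Sym_plus_def simp flip: Alt_on_UNIV intro: \<sigma>_Alt_on)
  have "S = {x + sc c 1 | x c. x \<in> Alt_plus sc \<sigma>}"
  proof (intro equalityI subsetI)
    fix x assume x: "x \<in> S"
    then obtain c where c: "x + sc c 1 \<in> Alt \<sigma>" using S0_Alt S by blast
    \<comment> \<open>Closure of \<open>S\<close> under adding scalars gives the alternating element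
      \<open>x + sc c 1\<close> a scalar square as well.\<close>
    have "x + sc c 1 \<in> S" using x one_S S_sc S_add by blast
    then have "x + sc c 1 \<in> Alt_plus sc \<sigma>" using c S0_sq S by (auto simp: Alt_plus_def)
    moreover have "x = (x + sc c 1) + sc c 1" by (simp add: add.assoc)
    ultimately show "x \<in> {x + sc c 1 | x c. x \<in> Alt_plus sc \<sigma>}" by blast
  next
    fix x assume "x \<in> {x + sc c 1 | x c. x \<in> Alt_plus sc \<sigma>}"
    then show "x \<in> S" using Alt_Sym one_S S_sc S_add by blast
  qed
  moreover have "Alt_plus sc \<sigma> \<inter> range (\<lambda>c. sc c 1) = {0}"
  proof -
    have "0 \<in> Alt_plus sc \<sigma>"
      using subspace_0[OF subspace_Alt_on[OF subspace_UNIV]]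
      by (auto simp: Alt_plus_def Alt_on_UNIV intro: exI[of _ "0::'f"])
    moreover have "c = 0" if "sc c 1 \<in> Alt_plus sc \<sigma>" for c
      using that sc_1_in_Alt by (simp add: Alt_plus_def Alt_on_UNIV)
    ultimately show ?thesis by (auto intro: range_eqI[of _ _ 0])
  qed
  moreover have "maximal_subfield sc S"
    unfolding maximal_subfield_def
  proof (intro conjI allI impI)
    \<comment> \<open>Anisotropy makes the scalar \<open>c\<close> in \<open>x * x = sc c 1\<close>
      nonzero, and \<open>sc (inverse c) x\<close> is then an inverse of \<open>x\<close> in
      \<open>S\<close>.\<close>
    have "\<exists>y\<in>S. x * y = 1" if x: "x \<in> S" "x \<noteq> 0" for x
    proof -
      obtain c where c: "x * x = sc c 1" "\<sigma> x = x" using S0_sq x S by blast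
      then have "c \<noteq> 0" using anisotropic[of x] x by auto
      then have "x * sc (inverse c) x = 1" using c by (simp add: sc_right)
      then show ?thesis using S_sc x by blast
    qed
    then show "subfield sc S" using alg S0_comm S by (auto simp: subfield_def)
  next
    fix L assume L: "subfield sc L \<and> S \<subseteq> L"
    \<comment> \<open>A commutative \<open>L\<close> containing \<open>S\<close> centralizes
      \<open>S\<close>, and \<open>S\<close> is its own centralizer.\<close>
    then have "L \<subseteq> centralizer UNIV S" by (auto simp: subfield_def centralizer_def)
    then show "L = S" using L cent by blast
  qed
  ultimately show ?thesis using Sym insep_eq S by blast
qed

end
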